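(* For $n\ge 3$, every normal automorphism of $T_n$ is inner.
   Context: For an integer $n\ge 2$, the twin group $T_n$ is the group generated by $s_1,\dots,s_{n-1}$ with defining relations $s_i^2=1$ for all $i$, and $s_is_j=s_js_i$ whenever $|i-j|\ge 2$. An automorphism of a group is normal if it maps every normal subgroup onto itself. *)

theory Defs
  imports "HOL-Algebra.Coset"
begin

section \<open>Groups given by generators and relations\<close>

text \<open>The letter \<open>(x, True)\<close> stands for the generator \<open>x\<close>, and \<open>(x, False)\<close> for its formal inverse.\<close>

type_synonym 'a word = "('a \<times> bool) list"

definition words :: "'a set \<Rightarrow> 'a word set" where
  "words X = lists (X \<times> UNIV)"

text \<open>A pair \<open>(u, v)\<close> in \<open>R\<close> is the defining relation \<open>u = v\<close>.\<close>

inductive_set pres_cong :: "'a set \<Rightarrow> ('a word \<times> 'a word) set \<Rightarrow> ('a word \<times> 'a word) set"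
  for X :: "'a set" and R :: "('a word \<times> 'a word) set" where
  refl: "w \<in> words X \<Longrightarrow> (w, w) \<in> pres_cong X R"
| sym: "(u, v) \<in> pres_cong X R \<Longrightarrow> (v, u) \<in> pres_cong X R"
| trans: "(u, v) \<in> pres_cong X R \<Longrightarrow> (v, w) \<in> pres_cong X R \<Longrightarrow> (u, w) \<in> pres_cong X R"
| append: "(u, u') \<in> pres_cong X R \<Longrightarrow> (v, v') \<in> pres_cong X R
    \<Longrightarrow> (u @ v, u' @ v') \<in> pres_cong X R"
| cancel: "x \<in> X \<Longrightarrow> ([(x, b), (x, \<not> b)], []) \<in> pres_cong X R"
| relation: "(u, v) \<in> R \<Longrightarrow> u \<in> words X \<Longrightarrow> v \<in> words X \<Longrightarrow> (u, v) \<in> pres_cong X R"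

definition presented_group :: "'a set \<Rightarrow> ('a word \<times> 'a word) set \<Rightarrow> 'a word set monoid" where
  "presented_group X R =
     \<lparr> carrier = words X // pres_cong X R,
       mult = (\<lambda>A B. \<Union>u\<in>A. \<Union>v\<in>B. pres_cong X R `` {u @ v}),
       one = pres_cong X R `` {[]} \<rparr>"

lemma words_Nil [simp]: "[] \<in> words X"
  by (simp add: words_def)

lemma words_append [simp]: "u @ v \<in> words X \<longleftrightarrow> u \<in> words X \<and> v \<in> words X"
  by (simp add: words_def)

lemma words_Cons [simp]: "p # w \<in> words X \<longleftrightarrow> fst p \<in> X \<and> w \<in> words X"
  by (cases p) (auto simp: words_def)

lemma pres_cong_words: "(u, v) \<in> pres_cong X R \<Longrightarrow> u \<in> words X \<and> v \<in> words X"
  by (induction rule: pres_cong.induct) auto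

lemma equiv_pres_cong: "equiv (words X) (pres_cong X R)"
proof (rule equivI)
  show "pres_cong X R \<subseteq> words X \<times> words X"
    by (auto dest: pres_cong_words)
  show "refl_on (words X) (pres_cong X R)"
    by (rule refl_onI) (rule pres_cong.refl)
  show "sym (pres_cong X R)"
    by (rule symI) (rule pres_cong.sym)
  show "trans (pres_cong X R)"
    by (rule transI) (rule pres_cong.trans)
qed

lemma presented_group_mult:
  assumes "u \<in> words X" "v \<in> words X"
  shows "pres_cong X R `` {u} \<otimes>\<^bsub>presented_group X R\<^esub> pres_cong X R `` {v}
           = pres_cong X R `` {u @ v}"
proof -
  have "pres_cong X R `` {u' @ v'} = pres_cong X R `` {u @ v}"
    if "(u, u') \<in> pres_cong X R" "(v, v') \<in> pres_cong X R" for u' v'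
    using equiv_class_eq[OF equiv_pres_cong pres_cong.append[OF that]] by simp
  then have "(\<Union>u'\<in>pres_cong X R `` {u}. \<Union>v'\<in>pres_cong X R `` {v}. pres_cong X R `` {u' @ v'})
      = (\<Union>u'\<in>pres_cong X R `` {u}. \<Union>v'\<in>pres_cong X R `` {v}. pres_cong X R `` {u @ v})"
    by (intro SUP_cong HOL.refl) (simp only: Image_singleton_iff)
  moreover have "u \<in> pres_cong X R `` {u}" "v \<in> pres_cong X R `` {v}"
    using assms by (simp_all add: pres_cong.refl)
  then have "pres_cong X R `` {u} \<noteq> {}" "pres_cong X R `` {v} \<noteq> {}"
    by blast+
  ultimately show ?thesis
    by (simp only: presented_group_def monoid.simps UN_constant if_False)
qed

lemma presented_group_carrier:
  "carrier (presented_group X R) = {pres_cong X R `` {w} |w. w \<in> words X}"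
  by (auto simp: presented_group_def quotient_def)

lemma presented_group_one:
  "\<one>\<^bsub>presented_group X R\<^esub> = pres_cong X R `` {[]}"
  by (simp add: presented_group_def)

definition inv_word :: "'a word \<Rightarrow> 'a word" where
  "inv_word w = rev (map (\<lambda>(x, b). (x, \<not> b)) w)"

lemma inv_word_words: "w \<in> words X \<Longrightarrow> inv_word w \<in> words X"
  by (induction w) (auto simp: inv_word_def)

lemma inv_word_cancel: "w \<in> words X \<Longrightarrow> (inv_word w @ w, []) \<in> pres_cong X R"
proof (induction w)
  case Nil
  then show ?case by (auto simp: inv_word_def intro: pres_cong.refl)
next
  case (Cons p w)
  obtain x b where p: "p = (x, b)" by (cases p)
  have w: "w \<in> words X" "x \<in> X" using Cons.prems by (auto simp: p)
  have c: "([(x, \<not> b), (x, b)], []) \<in> pres_cong X R"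
    using pres_cong.cancel[OF w(2), of "\<not> b"] by simp
  have "(inv_word w @ ([(x, \<not> b), (x, b)] @ w), inv_word w @ ([] @ w)) \<in> pres_cong X R"
    by (intro pres_cong.append c pres_cong.refl w inv_word_words)
  with Cons.IH[OF w(1)] have "(inv_word w @ ([(x, \<not> b), (x, b)] @ w), []) \<in> pres_cong X R"
    by (auto intro: pres_cong.trans)
  then show ?case by (simp add: inv_word_def p)
qed

lemma group_presented_group: "group (presented_group X R)"
proof (rule groupI)
  fix A assume "A \<in> carrier (presented_group X R)"
  then obtain w where w: "A = pres_cong X R `` {w}" "w \<in> words X"
    by (auto simp: presented_group_carrier)
  have "pres_cong X R `` {inv_word w} \<otimes>\<^bsub>presented_group X R\<^esub> A = \<one>\<^bsub>presented_group X R\<^esub>"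
    using w inv_word_words[OF w(2)]
      equiv_class_eq[OF equiv_pres_cong inv_word_cancel[OF w(2)]]
    by (simp add: presented_group_mult presented_group_one)
  then show "\<exists>B\<in>carrier (presented_group X R).
      B \<otimes>\<^bsub>presented_group X R\<^esub> A = \<one>\<^bsub>presented_group X R\<^esub>"
    using inv_word_words[OF w(2)] by (auto simp: presented_group_carrier)
next
  fix A B
  assume "A \<in> carrier (presented_group X R)" "B \<in> carrier (presented_group X R)"
  then obtain u v where uv: "A = pres_cong X R `` {u}" "u \<in> words X"
      "B = pres_cong X R `` {v}" "v \<in> words X"
    by (auto simp: presented_group_carrier)
  then have "A \<otimes>\<^bsub>presented_group X R\<^esub> B = pres_cong X R `` {u @ v}" "u @ v \<in> words X"
    by (simp_all add: presented_group_mult)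
  then show "A \<otimes>\<^bsub>presented_group X R\<^esub> B \<in> carrier (presented_group X R)"
    unfolding presented_group_carrier by blast
  fix C assume "C \<in> carrier (presented_group X R)"
  then obtain w where "C = pres_cong X R `` {w}" "w \<in> words X"
    by (auto simp: presented_group_carrier)
  with uv show "A \<otimes>\<^bsub>presented_group X R\<^esub> B \<otimes>\<^bsub>presented_group X R\<^esub> C
      = A \<otimes>\<^bsub>presented_group X R\<^esub> (B \<otimes>\<^bsub>presented_group X R\<^esub> C)"
    by (simp add: presented_group_mult)
next
  show "\<one>\<^bsub>presented_group X R\<^esub> \<in> carrier (presented_group X R)"
    unfolding presented_group_carrier presented_group_one using words_Nil by blast
next
  fix A assume "A \<in> carrier (presented_group X R)"
  then obtain w where "A = pres_cong X R `` {w}" "w \<in> words X"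
    by (auto simp: presented_group_carrier)
  then show "\<one>\<^bsub>presented_group X R\<^esub> \<otimes>\<^bsub>presented_group X R\<^esub> A = A"
    by (simp add: presented_group_mult presented_group_one)
qed

section \<open>Twin groups\<close>

abbreviation gen :: "'a \<Rightarrow> 'a \<times> bool" where
  "gen x \<equiv> (x, True)"

definition twin_relations :: "nat \<Rightarrow> (nat word \<times> nat word) set" where
  "twin_relations n =
     {([gen i, gen i], []) | i. i \<in> {1..n - 1}}
     \<union> {([gen i, gen j], [gen j, gen i]) | i j.
          i \<in> {1..n - 1} \<and> j \<in> {1..n - 1} \<and> \<bar>int i - int j\<bar> \<ge> 2}"

definition twin_group :: "nat \<Rightarrow> nat word set monoid" where
  "twin_group n = presented_group {1..n - 1} (twin_relations n)"

lemma group_twin_group: "group (twin_group n)"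
  unfolding twin_group_def by (rule group_presented_group)

section \<open>Normal and inner automorphisms\<close>

definition normal_automorphism :: "('a, 'b) monoid_scheme \<Rightarrow> ('a \<Rightarrow> 'a) \<Rightarrow> bool" where
  "normal_automorphism G \<phi> \<longleftrightarrow> \<phi> \<in> iso G G \<and> (\<forall>N. N \<lhd> G \<longrightarrow> \<phi> ` N = N)"

text \<open>Functions on \<open>G\<close> are only constrained on the carrier, so equality with a conjugation is
  required there and nowhere else.\<close>

definition inner_automorphism :: "('a, 'b) monoid_scheme \<Rightarrow> ('a \<Rightarrow> 'a) \<Rightarrow> bool" where
  "inner_automorphism G \<phi> \<longleftrightarrow>
     (\<exists>g\<in>carrier G. \<forall>x\<in>carrier G. \<phi> x = g \<otimes>\<^bsub>G\<^esub> x \<otimes>\<^bsub>G\<^esub> inv\<^bsub>G\<^esub> g)"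

end

theory Submission
  imports Defs
begin

text \<open>
  The twin group is a right-angled Coxeter group.  A normal automorphism preserves the kernels of
  all maps to the group of order two that send \<open>s\<^sub>i\<close> to the generator and the other \<open>s\<^sub>j\<close> to the
  identity.  Hence the image \<open>R\<^sub>i\<close> of \<open>s\<^sub>i\<close> is an involution that contains \<open>s\<^sub>i\<close> an odd number of
  times and every other generator an even number of times, and such an involution is conjugate
  to \<open>s\<^sub>i\<close>.

  The \<open>R\<^sub>i\<close> are then conjugated to the \<open>s\<^sub>i\<close> simultaneously, by induction on the interval of indices.
  Assume that \<open>R\<^sub>k = s\<^sub>k\<close> for the least index \<open>k\<close>.  The \<open>R\<^sub>i\<close> with \<open>i \<ge> k + 2\<close> centralize \<open>s\<^sub>k\<close>,
  so they lie in the subgroup generated by the \<open>s\<^sub>i\<close> with \<open>i \<ge> k + 2\<close>, where the induction hypothesis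
  yields a conjugator, which commutes with \<open>s\<^sub>k\<close>.  After this conjugation only \<open>R\<^bsub>k+1\<^esub>\<close> is left.  Since it
  centralizes \<open>s\<^sub>i\<close> for \<open>i \<ge> k + 3\<close>, it lies in the free product of \<open>\<langle>s\<^sub>k, s\<^bsub>k+2\<^esub>\<rangle>\<close> and
  \<open>\<langle>s\<^bsub>k+1\<^esub>\<rangle>\<close>.  Together with the first factor it generates this free product, which forces it to be a
  conjugate of \<open>s\<^bsub>k+1\<^esub>\<close> by an element of the first factor.
\<close>

section \<open>Reduced words\<close>

text \<open>The letter \<open>i\<close> stands for \<open>s\<^sub>i\<close>, and \<open>dep\<close> holds for pairs of letters that are
  not required to commute, including equal ones.\<close>

definition dep :: "nat \<Rightarrow> nat \<Rightarrow> bool" where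
  "dep i j \<longleftrightarrow> i \<le> Suc j \<and> j \<le> Suc i"

lemma dep_refl [simp]: "dep i i"
  by (simp add: dep_def)

lemma dep_sym: "dep i j \<Longrightarrow> dep j i"
  by (simp add: dep_def)

definition proj :: "nat \<Rightarrow> nat \<Rightarrow> nat list \<Rightarrow> nat list" where
  "proj s t = filter (\<lambda>x. x = s \<or> x = t)"

lemma proj_simps [simp]:
  "proj s t [] = []"
  "proj s t (x # w) = (if x = s \<or> x = t then x # proj s t w else proj s t w)"
  "proj s t (u @ v) = proj s t u @ proj s t v"
  "proj s t (rev w) = rev (proj s t w)"
  "proj s t (remove1 x w) = remove1 x (proj s t w)"
  "set (proj s t w) = {x \<in> set w. x = s \<or> x = t}"
  by (auto simp: proj_def rev_filter filter_remove1)

lemma proj_commute: "proj s t = proj t s"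
  by (auto simp: proj_def disj_commute)

text \<open>Two words represent the same element of the partially commutative monoid if and only if
  they have the same projections to all pairs of dependent letters.  The choice \<open>s = t\<close> compares
  numbers of occurrences.\<close>

definition teq :: "nat list \<Rightarrow> nat list \<Rightarrow> bool" where
  "teq u v \<longleftrightarrow> (\<forall>s t. dep s t \<longrightarrow> proj s t u = proj s t v)"

lemma teq_refl [simp]: "teq u u"
  by (simp add: teq_def)

lemma teq_sym: "teq u v \<Longrightarrow> teq v u"
  by (simp add: teq_def)

lemma teq_trans [trans]: "teq u v \<Longrightarrow> teq v w \<Longrightarrow> teq u w"
  by (simp add: teq_def)

lemma teq_append: "teq u u' \<Longrightarrow> teq v v' \<Longrightarrow> teq (u @ v) (u' @ v')"
  by (simp add: teq_def)

lemma teq_append_cancel: "teq (u @ v) (u @ v') \<Longrightarrow> teq v v'"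
  by (simp add: teq_def)

lemma teq_Cons_iff [simp]: "teq (s # u) (s # v) \<longleftrightarrow> teq u v"
  using teq_append[of "[s]" "[s]" u v] teq_append_cancel[of "[s]" u v] by auto

lemma teq_rev: "teq u v \<Longrightarrow> teq (rev u) (rev v)"
  by (simp add: teq_def)

lemma teq_swap: "\<not> dep s t \<Longrightarrow> teq (s # t # w) (t # s # w)"
  by (auto simp: teq_def dest: dep_sym)

lemma teq_remove1: "teq u v \<Longrightarrow> teq (remove1 s u) (remove1 s v)"
  by (simp add: teq_def)

lemma count_list_proj: "count_list w s = length (proj s s w)"
  by (induction w) auto

lemma teq_count: "teq u v \<Longrightarrow> count_list u s = count_list v s"
  by (simp add: count_list_proj teq_def)

lemma teq_set:
  assumes "teq u v"
  shows "set u = set v"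
proof (rule Set.set_eqI)
  fix x
  have "count_list u x = count_list v x" using assms by (rule teq_count)
  then show "x \<in> set u \<longleftrightarrow> x \<in> set v"
    using count_list_0_iff[of u x] count_list_0_iff[of v x] by simp
qed

text \<open>\<open>desc s w\<close> says that some occurrence of \<open>s\<close> in \<open>w\<close> can be moved to the front.\<close>

primrec desc :: "nat \<Rightarrow> nat list \<Rightarrow> bool" where
  "desc s [] \<longleftrightarrow> False"
| "desc s (t # w) \<longleftrightarrow> s = t \<or> (\<not> dep s t \<and> desc s w)"

text \<open>A letter that blocks \<open>s\<close> appears ahead of \<open>s\<close> in the
  projection to these two letters, while independent letters are invisible here. The instance
  \<open>t = s\<close> guarantees that \<open>s\<close> occurs at all.\<close>

lemma desc_iff_proj: "desc s w \<longleftrightarrow> (\<forall>t. dep s t \<longrightarrow> (\<exists>ys. proj s t w = s # ys))"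
proof (induction w)
  case Nil
  then show ?case using dep_refl[of s] by (auto simp del: dep_refl)
next
  case (Cons x w)
  show ?case
  proof (cases "x = s")
    case False
    show ?thesis
    proof (cases "dep s x")
      case True
      then have "\<not> (\<exists>ys. proj s x (x # w) = s # ys)" using False by auto
      then show ?thesis using True False by auto
    next
      case indep: False
      have "proj s t (x # w) = proj s t w" if "dep s t" for t
        using that False indep by auto
      then show ?thesis using Cons.IH indep False by auto
    qed
  qed auto
qed

lemma desc_teq: "teq u v \<Longrightarrow> desc s u = desc s v"
  by (simp add: desc_iff_proj teq_def)

lemma desc_append: "desc s (u @ v) \<longleftrightarrow> desc s u \<or> ((\<forall>x\<in>set u. \<not> dep s x) \<and> desc s v)"
  by (induction u) auto

lemma desc_imp_mem: "desc s w \<Longrightarrow> s \<in> set w"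
  by (induction w) auto

lemma desc_imp_teq:
  assumes "desc s w"
  shows "teq w (s # remove1 s w)"
proof -
  have "proj a b w = proj a b (s # remove1 s w)" if ab: "dep a b" for a b
  proof (cases "s = a \<or> s = b")
    case True
    then obtain t where t: "dep s t" "proj a b = proj s t"
      using ab proj_commute dep_sym by metis
    then obtain ys where "proj s t w = s # ys" using assms by (auto simp: desc_iff_proj)
    then show ?thesis using t by simp
  next
    case False
    then have "s \<notin> set (proj a b w)" by auto
    then show ?thesis using False by (simp add: remove1_idem)
  qed
  then show ?thesis by (simp add: teq_def)
qed

lemma teq_Cons_desc:
  assumes "teq (s # u) v"
  shows "desc s v" "teq u (remove1 s v)"
proof -
  show d: "desc s v" using desc_teq[OF assms, of s] by simp
  have "teq (s # u) (s # remove1 s v)"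
    using assms desc_imp_teq[OF d] by (rule teq_trans)
  then show "teq u (remove1 s v)" by simp
qed

lemma teq_length: "teq u v \<Longrightarrow> length u = length v"
proof (induction u arbitrary: v)
  case Nil
  then show ?case using teq_set[of "[]" v] by simp
next
  case (Cons s u)
  have "s \<in> set v" by (rule desc_imp_mem[OF teq_Cons_desc(1)[OF Cons.prems]])
  then have "length v = Suc (length (remove1 s v))"
    using length_pos_if_in_set[of s v] by (simp add: length_remove1)
  then show ?case using Cons.IH[OF teq_Cons_desc(2)[OF Cons.prems]] by simp
qed

text \<open>Reduced means that no two equal letters can be brought next to each other by
  commutations.\<close>

primrec red :: "nat list \<Rightarrow> bool" where
  "red [] \<longleftrightarrow> True"
| "red (s # w) \<longleftrightarrow> red w \<and> \<not> desc s w"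

lemma red_insert:
  "desc s w \<Longrightarrow> red (s # remove1 s w) \<Longrightarrow> red w"
proof (induction w)
  case (Cons t w)
  show ?case
  proof (cases "s = t")
    case False
    then have st: "\<not> dep s t" "\<not> dep t s" "desc s w"
      using Cons.prems dep_sym by auto
    then have w: "red w" using Cons False by auto
    have "desc t w \<longleftrightarrow> desc t (s # remove1 s w)"
      by (rule desc_teq[OF desc_imp_teq[OF st(3)]])
    then have "\<not> desc t w" using Cons.prems False st by auto
    then show ?thesis using w by simp
  qed (use Cons.prems in auto)
qed auto

lemma red_teq: "teq u v \<Longrightarrow> red u \<Longrightarrow> red v"
proof (induction u arbitrary: v)
  case Nil
  then show ?case using teq_length[of "[]" v] by simp
next
  case (Cons s u)
  note d = teq_Cons_desc(1)[OF Cons.prems(1)] and u = teq_Cons_desc(2)[OF Cons.prems(1)]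
  have "red (s # remove1 s v)" using Cons.IH[OF u] Cons.prems(2) desc_teq[OF u, of s] by auto
  then show ?case using d by (rule red_insert[rotated])
qed

lemma red_appendD1: "red (u @ v) \<Longrightarrow> red u"
  by (induction u) (auto simp: desc_append)

lemma red_append: "red u \<Longrightarrow> red v \<Longrightarrow> \<forall>x\<in>set u. \<not> desc x v \<Longrightarrow> red (u @ v)"
  by (induction u) (auto simp: desc_append)

text \<open>Since all letters of \<open>u\<close> depend on \<open>b\<close>, this \<open>b\<close>
  keeps them from meeting letters of \<open>v\<close>.\<close>

lemma red_append_dep: "red (u @ [b]) \<Longrightarrow> \<forall>x\<in>set u. dep x b \<Longrightarrow> red (b # v) \<Longrightarrow> red (u @ b # v)"
  by (induction u) (auto simp: desc_append)

section \<open>Normal forms\<close>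

text \<open>Left multiplication by \<open>s\<close> on reduced words, as in van der Waerden's proof
  of the normal form theorem for free products.\<close>

definition act :: "nat \<Rightarrow> nat list \<Rightarrow> nat list" where
  "act s w = (if desc s w then remove1 s w else s # w)"

lemma red_act: "red w \<Longrightarrow> red (act s w)"
  using red_teq[OF desc_imp_teq, of s w] by (cases "desc s w") (simp_all add: act_def)

lemma act_teq: "teq u v \<Longrightarrow> teq (act s u) (act s v)"
  by (simp add: act_def desc_teq teq_remove1)

lemma act_act:
  assumes "red w"
  shows "teq (act s (act s w)) w"
proof (cases "desc s w")
  case True
  then have "teq w (s # remove1 s w)" by (rule desc_imp_teq)
  then have "\<not> desc s (remove1 s w)" using red_teq[OF _ assms, of "s # remove1 s w"] by simp
  then show ?thesis using True desc_imp_teq[OF True] by (simp add: act_def teq_sym)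
qed (simp add: act_def)

lemma desc_act:
  assumes "\<not> dep s t"
  shows "desc s (act t w) = desc s w"
proof (cases "desc t w")
  case True
  then show ?thesis
    using desc_teq[OF desc_imp_teq[OF True], of s] assms by (auto simp: act_def)
qed (use assms in \<open>auto simp: act_def\<close>)

lemma act_commute:
  assumes "\<not> dep s t"
  shows "teq (act s (act t w)) (act t (act s w))"
proof -
  have ts: "\<not> dep t s" and ne: "s \<noteq> t" using assms dep_sym by auto
  have "desc s (act t w) = desc s w" "desc t (act s w) = desc t w"
    using desc_act assms ts by auto
  then show ?thesis
    using ne assms ts by (auto simp: act_def remove1_commute intro: teq_swap)
qed

definition nf :: "nat list \<Rightarrow> nat list" where
  "nf w = foldr act w []"

lemma nf_simps [simp]: "nf [] = []" "nf (s # w) = act s (nf w)"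
  by (simp_all add: nf_def)

lemma red_nf [simp]: "red (nf w)"
  by (induction w) (auto intro: red_act)

lemma nf_red [simp]: "red w \<Longrightarrow> nf w = w"
  by (induction w) (auto simp: act_def)

lemma length_act: "length (act s w) \<le> Suc (length w)"
  by (auto simp: act_def length_remove1)

lemma length_nf: "length (nf w) \<le> length w"
proof (induction w)
  case (Cons s w)
  then show ?case using length_act[of s "nf w"] by simp
qed simp

text \<open>Each letter lengthens the normal form by at most one, so equal length means that nothing
  cancels. Reducedness can thus be read off from the length of the element.\<close>

lemma red_if_length_nf: "length (nf w) = length w \<Longrightarrow> red w"
proof (induction w)
  case (Cons s w)
  have "length (nf w) = length w"
    using Cons.prems length_act[of s "nf w"] length_nf[of w] by simp
  then have "red w" by (rule Cons.IH)
  moreover have "\<not> desc s w"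
    using Cons.prems \<open>red w\<close> by (auto simp: act_def length_remove1 split: if_splits)
  ultimately show ?case by simp
qed simp

lemma set_act: "set (act s w) \<subseteq> insert s (set w)"
  using set_remove1_subset[of s w] by (auto simp: act_def)

lemma set_nf: "set (nf w) \<subseteq> set w"
  using set_act by (induction w) fastforce+

text \<open>Defining equality by normal forms settles the word problem at once; agreement with the
  presentation is the content of \<open>pres_cong_abs_twin\<close> and
  \<open>to_twin_inj\<close>.\<close>

definition tw_eq :: "nat list \<Rightarrow> nat list \<Rightarrow> bool" where
  "tw_eq u v \<longleftrightarrow> teq (nf u) (nf v)"

text \<open>The universal property of the group presented by the relations \<open>s\<^sub>i\<^sup>2 = 1\<close> and
  \<open>s\<^sub>i s\<^sub>j = s\<^sub>j s\<^sub>i\<close>, in terms of actions: \<open>E\<close> is a partial equivalence relation whose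
  domain is the set acted upon, modulo \<open>E\<close>.\<close>

locale twin_action =
  fixes E :: "'b \<Rightarrow> 'b \<Rightarrow> bool" and F :: "nat \<Rightarrow> 'b \<Rightarrow> 'b"
  assumes E_sym: "E x y \<Longrightarrow> E y x"
    and E_trans: "E x y \<Longrightarrow> E y z \<Longrightarrow> E x z"
    and F_cong: "E x y \<Longrightarrow> E (F s x) (F s y)"
    and F_invol: "E x x \<Longrightarrow> E (F s (F s x)) x"
    and F_commute: "E x x \<Longrightarrow> \<not> dep s t \<Longrightarrow> E (F s (F t x)) (F t (F s x))"
begin

lemma foldr_cong: "E x y \<Longrightarrow> E (foldr F u x) (foldr F u y)"
  by (induction u) (auto intro: F_cong)

lemma foldr_desc:
  assumes "E x x" "desc s w"
  shows "E (foldr F w x) (F s (foldr F (remove1 s w) x))"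
  using assms(2)
proof (induction w)
  case (Cons t w)
  show ?case
  proof (cases "s = t")
    case False
    then have st: "\<not> dep s t" "desc s w" using Cons.prems by auto
    let ?y = "foldr F (remove1 s w) x"
    have "E (F t (foldr F w x)) (F t (F s ?y))"
      by (rule F_cong[OF Cons.IH[OF st(2)]])
    moreover have "E (F t (F s ?y)) (F s (F t ?y))"
      by (rule E_sym[OF F_commute[OF foldr_cong[OF assms(1)] st(1)]])
    ultimately show ?thesis using False by (auto intro: E_trans)
  qed (use foldr_cong[OF assms(1), of "t # w"] in auto)
qed simp

lemma foldr_teq: "E x x \<Longrightarrow> teq u v \<Longrightarrow> E (foldr F u x) (foldr F v x)"
proof (induction u arbitrary: v)
  case Nil
  then show ?case using teq_length[of "[]" v] by simp
next
  case (Cons s u)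
  note d = teq_Cons_desc(1)[OF Cons.prems(2)]
  have "E (foldr F u x) (foldr F (remove1 s v) x)"
    using Cons.IH[OF Cons.prems(1) teq_Cons_desc(2)[OF Cons.prems(2)]] .
  then have "E (foldr F (s # u) x) (F s (foldr F (remove1 s v) x))"
    by (simp add: F_cong)
  then show ?case
    using E_sym[OF foldr_desc[OF Cons.prems(1) d]] by (rule E_trans)
qed

lemma foldr_nf: "E x x \<Longrightarrow> E (foldr F u x) (foldr F (nf u) x)"
proof (induction u)
  case (Cons s u)
  then have IH: "E (F s (foldr F u x)) (F s (foldr F (nf u) x))" by (auto intro: F_cong)
  show ?case
  proof (cases "desc s (nf u)")
    case True
    let ?y = "foldr F (remove1 s (nf u)) x"
    have "E (F s (foldr F (nf u) x)) (F s (F s ?y))"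
      by (rule F_cong[OF foldr_desc[OF Cons.prems True]])
    moreover have "E (F s (F s ?y)) ?y"
      by (rule F_invol[OF foldr_cong[OF Cons.prems]])
    ultimately have "E (F s (foldr F u x)) ?y" using IH E_trans by blast
    then show ?thesis using True by (simp add: act_def)
  qed (use IH in \<open>simp add: act_def\<close>)
qed simp

text \<open>Passing to a normal form and between equivalent ones uses only commutations and
  cancellations of squares, and \<open>F\<close> respects both.\<close>

lemma foldr_tw_eq:
  assumes "E x x" "tw_eq u v"
  shows "E (foldr F u x) (foldr F v x)"
proof -
  have "E (foldr F (nf u) x) (foldr F (nf v) x)"
    using foldr_teq[OF assms(1)] assms(2) by (simp add: tw_eq_def)
  then show ?thesis
    using foldr_nf[OF assms(1)] E_sym E_trans by blast
qed

end

lemma nf_append: "nf (u @ v) = foldr act u (nf v)"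
  by (simp add: nf_def)

interpretation act: twin_action "\<lambda>u v. red u \<and> red v \<and> teq u v" act
  by standard (auto intro: teq_sym teq_trans act_teq act_act act_commute red_act)

lemma tw_eq_append:
  assumes "tw_eq u u'" "tw_eq v v'"
  shows "tw_eq (u @ v) (u' @ v')"
proof -
  have "teq (nf (u @ v)) (nf (u @ v'))"
    using act.foldr_cong[of "nf v" "nf v'" u] assms(2)
    by (simp add: tw_eq_def nf_append)
  also have "teq (nf (u @ v')) (nf (u' @ v'))"
    using act.foldr_tw_eq[of "nf v'" u u'] assms(1)
    by (simp add: nf_append)
  finally show ?thesis by (simp add: tw_eq_def)
qed

lemma tw_eq_equivp: "equivp tw_eq"
  by (rule equivpI) (auto simp: tw_eq_def reflp_def symp_def transp_def intro: teq_sym teq_trans)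

lemma tw_eq_refl [simp]: "tw_eq u u"
  by (simp add: tw_eq_def)

lemma tw_eq_sym: "tw_eq u v \<Longrightarrow> tw_eq v u"
  by (simp add: tw_eq_def teq_sym)

lemma tw_eq_trans [trans]: "tw_eq u v \<Longrightarrow> tw_eq v w \<Longrightarrow> tw_eq u w"
  using equivp_transp[OF tw_eq_equivp] .

lemma tw_eq_cancel: "tw_eq [s, s] []"
  by (simp add: tw_eq_def act_def)

lemma tw_eq_swap: "\<not> dep s t \<Longrightarrow> tw_eq [s, t] [t, s]"
  using act_commute[of s t "[]"] by (simp add: tw_eq_def)

lemma tw_eq_rev_append: "tw_eq (rev w @ w) []"
proof (induction w)
  case (Cons s w)
  have "tw_eq (rev w @ [s, s] @ w) (rev w @ [] @ w)"
    by (intro tw_eq_append tw_eq_cancel tw_eq_refl)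
  then show ?case using Cons.IH by (auto intro: tw_eq_trans)
qed simp

lemma tw_eq_rev:
  assumes "tw_eq u v"
  shows "tw_eq (rev u) (rev v)"
proof -
  have "tw_eq (rev u) (rev u @ v @ rev v)"
    using tw_eq_append[OF tw_eq_refl[of "rev u"] tw_eq_sym[OF tw_eq_rev_append[of "rev v"]]] by simp
  also have "tw_eq (rev u @ v @ rev v) (rev u @ u @ rev v)"
    by (intro tw_eq_append tw_eq_refl tw_eq_sym[OF assms])
  also have "tw_eq (rev u @ u @ rev v) (rev v)"
    using tw_eq_append[OF tw_eq_rev_append[of u] tw_eq_refl[of "rev v"]] by simp
  finally show ?thesis .
qed

section \<open>The twin group on infinitely many generators\<close>

text \<open>The group is written additively in order to use the type class of
  (not necessarily commutative) additive groups.\<close>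

quotient_type twin = "nat list" / tw_eq
  by (rule tw_eq_equivp)

instantiation twin :: group_add
begin

lift_definition zero_twin :: twin is "[]" .
lift_definition plus_twin :: "twin \<Rightarrow> twin \<Rightarrow> twin" is "(@)" by (rule tw_eq_append)
lift_definition uminus_twin :: "twin \<Rightarrow> twin" is rev by (rule tw_eq_rev)
definition minus_twin :: "twin \<Rightarrow> twin \<Rightarrow> twin" where "minus_twin x y = x + - y"

instance
proof
  fix a b c :: twin
  show "a + b + c = a + (b + c)" by transfer simp
  show "0 + a = a" by transfer simp
  show "a + 0 = a" by transfer simp
  show "- a + a = 0" by transfer (rule tw_eq_rev_append)
  show "a + - b = a - b" by (simp add: minus_twin_def)
qed

end

lift_definition tgen :: "nat \<Rightarrow> twin" is "\<lambda>s. [s]" .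

lemma abs_twin_simps:
  "abs_twin [] = 0"
  "abs_twin (s # w) = tgen s + abs_twin w"
  "abs_twin (u @ v) = abs_twin u + abs_twin v"
  "abs_twin (rev w) = - abs_twin w"
  by (transfer, simp)+

lemma tgen_add_tgen [simp]: "tgen s + tgen s = 0"
  by transfer (simp add: tw_eq_cancel)

lemma minus_tgen [simp]: "- tgen s = tgen s"
  by (rule minus_unique) simp

lemma tgen_add_tgen_left [simp]: "tgen s + (tgen s + x) = x"
  by (simp flip: add.assoc)

lemma tgen_commute: "\<not> dep s t \<Longrightarrow> tgen s + tgen t = tgen t + tgen s"
  by transfer (simp add: tw_eq_swap)

lemma red_repE:
  obtains w where "red w" "x = abs_twin w"
proof -
  obtain w where "x = abs_twin w" by (induction x rule: twin.abs_induct) blast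
  moreover have "tw_eq w (nf w)" by (simp add: tw_eq_def)
  ultimately show thesis using that[of "nf w"] twin.abs_eq_iff by simp
qed

lemma abs_twin_eq_iff: "red u \<Longrightarrow> red v \<Longrightarrow> abs_twin u = abs_twin v \<longleftrightarrow> teq u v"
  by (simp add: twin.abs_eq_iff tw_eq_def)

text \<open>All reduced words of an element have the same letters. They form the least set of
  generators whose subgroup contains the element.\<close>

lift_definition supp :: "twin \<Rightarrow> nat set" is "\<lambda>w. set (nf w)"
  by (simp add: tw_eq_def teq_set)

lemma supp_abs_twin: "red w \<Longrightarrow> supp (abs_twin w) = set w"
  by transfer simp

lemma supp_abs_twin_subset: "supp (abs_twin w) \<subseteq> set w"
  by transfer (rule set_nf)

lift_definition len :: "twin \<Rightarrow> nat" is "\<lambda>w. length (nf w)"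
  by (simp add: tw_eq_def teq_length)

lemma len_abs_twin: "red w \<Longrightarrow> len (abs_twin w) = length w"
  by transfer simp

lemma red_if_len: "len (abs_twin w) = length w \<Longrightarrow> red w"
  by transfer (rule red_if_length_nf)

section \<open>Homomorphisms to the group of order two\<close>

lemma odd_count_act: "odd (count_list (act s w) t) \<longleftrightarrow> odd (count_list (s # w) t)"
proof (cases "desc s w")
  case True
  have "count_list w t = count_list (s # remove1 s w) t"
    by (rule teq_count[OF desc_imp_teq[OF True]])
  moreover have "act s w = remove1 s w" using True by (simp add: act_def)
  ultimately show ?thesis by (cases "s = t") simp_all
qed (simp add: act_def)

lemma odd_count_nf: "odd (count_list (nf w) t) \<longleftrightarrow> odd (count_list w t)"
  by (induction w) (simp_all add: odd_count_act)

text \<open>The group of order two is \<open>bool\<close> with exclusive or.\<close>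

lift_definition par :: "nat \<Rightarrow> twin \<Rightarrow> bool" is "\<lambda>s w. odd (count_list w s)"
proof -
  fix s :: nat and u v assume "tw_eq u v"
  then have "count_list (nf u) s = count_list (nf v) s"
    unfolding tw_eq_def by (rule teq_count)
  then show "odd (count_list u s) \<longleftrightarrow> odd (count_list v s)"
    using odd_count_nf[of u s] odd_count_nf[of v s] by simp
qed

lemma par_simps [simp]:
  "\<not> par s 0"
  "par s (x + y) \<longleftrightarrow> par s x \<noteq> par s y"
  "par s (- x) \<longleftrightarrow> par s x"
  "par s (x - y) \<longleftrightarrow> par s x \<noteq> par s y"
  "par s (tgen t) \<longleftrightarrow> s = t"
proof -
  show p: "par s (x + y) \<longleftrightarrow> par s x \<noteq> par s y" for x y by transfer auto
  show m: "par s (- x) \<longleftrightarrow> par s x" for x by transfer (simp add: count_list_rev)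
  show "par s (x - y) \<longleftrightarrow> par s x \<noteq> par s y"
    unfolding minus_twin_def by (simp only: p m)
qed (transfer, simp)+

lemma par_imp_supp: "par s x \<Longrightarrow> s \<in> supp x"
  by transfer (metis odd_count_nf count_list_0_iff even_zero)

section \<open>Retractions onto subgroups generated by sets of generators\<close>

lift_definition ret :: "nat set \<Rightarrow> twin \<Rightarrow> twin" is "\<lambda>I. filter (\<lambda>x. x \<in> I)"
proof -
  fix I :: "nat set" and u v assume uv: "tw_eq u v"
  \<comment> \<open>Letters outside \<open>I\<close> act as the identity, which is compatible with
    the relations; on the empty word this action deletes them.\<close>
  define F where "F = (\<lambda>s x. if s \<in> I then s # x else x)"
  have "twin_action tw_eq F"
  proof
    fix s t x y
    show "tw_eq (F s x) (F s y)" if "tw_eq x y"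
      using tw_eq_append[OF tw_eq_refl[of "[s]"] that] that by (simp add: F_def)
    show "tw_eq (F s (F s x)) x"
      using tw_eq_append[OF tw_eq_cancel[of s] tw_eq_refl[of x]] by (simp add: F_def)
    show "tw_eq (F s (F t x)) (F t (F s x))" if "\<not> dep s t"
      using tw_eq_append[OF tw_eq_swap[OF that] tw_eq_refl[of x]] by (simp add: F_def)
  qed (fact tw_eq_sym, fact tw_eq_trans)
  from twin_action.foldr_tw_eq[OF this tw_eq_refl uv]
  have "tw_eq (foldr F u []) (foldr F v [])" .
  moreover have "foldr F w [] = filter (\<lambda>x. x \<in> I) w" for w
    by (induction w) (auto simp: F_def)
  ultimately show "tw_eq (filter (\<lambda>x. x \<in> I) u) (filter (\<lambda>x. x \<in> I) v)" by simp
qed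

lemma ret_simps [simp]:
  "ret I 0 = 0"
  "ret I (x + y) = ret I x + ret I y"
  "ret I (- x) = - ret I x"
  "ret I (x - y) = ret I x - ret I y"
  "ret I (tgen t) = (if t \<in> I then tgen t else 0)"
proof -
  show p: "ret I (x + y) = ret I x + ret I y" for x y by transfer simp
  show m: "ret I (- x) = - ret I x" for x by transfer (simp add: rev_filter)
  show "ret I (x - y) = ret I x - ret I y"
    unfolding minus_twin_def by (simp only: p m)
qed (transfer, simp)+

lemma supp_ret: "supp (ret I x) \<subseteq> I"
proof -
  have "set (nf (filter (\<lambda>x. x \<in> I) w)) \<subseteq> I" for w
    using set_nf[of "filter (\<lambda>x. x \<in> I) w"] by auto
  then show ?thesis by transfer
qed

lemma ret_id:
  assumes "supp x \<subseteq> I"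
  shows "ret I x = x"
proof -
  obtain w where w: "red w" "x = abs_twin w" by (rule red_repE)
  then have "set w \<subseteq> I" using assms by (simp add: supp_abs_twin)
  then have "filter (\<lambda>x. x \<in> I) w = w" by (auto intro: filter_True)
  then show ?thesis using w by (simp add: ret.abs_eq)
qed

text \<open>Support in \<open>I\<close> becomes a fixed point condition for a homomorphism, so
  closure under the group operations is immediate.\<close>

lemma supp_subset_iff_ret: "supp x \<subseteq> I \<longleftrightarrow> ret I x = x"
  using ret_id supp_ret by metis

lemma supp_add_subset: "supp x \<subseteq> I \<Longrightarrow> supp y \<subseteq> I \<Longrightarrow> supp (x + y) \<subseteq> I"
  by (simp add: supp_subset_iff_ret)

lemma supp_minus_subset: "supp x \<subseteq> I \<Longrightarrow> supp (- x) \<subseteq> I"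
  by (simp add: supp_subset_iff_ret)

lemma supp_0 [simp]: "supp 0 = {}"
  using supp_subset_iff_ret[of 0 "{}"] by simp

lemma supp_tgen [simp]: "supp (tgen s) = {s}"
  by transfer (simp add: act_def)

section \<open>Centralizers of generators\<close>

lemma tgen_commute_supp:
  assumes "\<forall>t\<in>supp x. t = s \<or> \<not> dep s t"
  shows "tgen s + x = x + tgen s"
proof -
  have "tgen s + abs_twin w = abs_twin w + tgen s" if "\<forall>t\<in>set w. t = s \<or> \<not> dep s t" for w
    using that
  proof (induction w)
    case (Cons t w)
    then have "tgen s + tgen t = tgen t + tgen s" using tgen_commute by auto
    then have "tgen s + abs_twin (t # w) = tgen t + (tgen s + abs_twin w)"
      by (simp add: abs_twin_simps flip: add.assoc)
    also have "\<dots> = abs_twin (t # w) + tgen s"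
      using Cons by (simp add: abs_twin_simps add.assoc)
    finally show ?case .
  qed (simp add: abs_twin_simps)
  then show ?thesis using assms by (metis red_repE supp_abs_twin)
qed

lemma Cons_eq_snoc_imp: "s # w = w @ [s] \<Longrightarrow> set w \<subseteq> {s}"
  by (induction w) auto

lemma dep_only_self_imp_desc:
  "s \<in> set w \<Longrightarrow> \<forall>t\<in>set w. dep s t \<longrightarrow> t = s \<Longrightarrow> desc s w"
  by (induction w) auto

text \<open>If \<open>s\<close> is no descent of a reduced word \<open>w\<close> of
  \<open>x\<close>, then \<open>s w\<close> and \<open>w s\<close> are both reduced, and their
  projections show that no letter of \<open>w\<close> depends on \<open>s\<close>. If
  \<open>s\<close> is a descent, the same holds for the rest of the word, so \<open>s\<close> occurs
  exactly once, against the parity.\<close>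

lemma supp_centralizer:
  assumes comm: "tgen s + x = x + tgen s" and par: "\<not> par s x" and t: "t \<in> supp x"
  shows "\<not> dep s t"
proof -
  have *: "\<not> dep s t"
    if w: "red w" "\<not> desc s w" "tgen s + abs_twin w = abs_twin w + tgen s" "t \<in> set w" for w t
  proof -
    have sw: "red (s # w)" using w by simp
    have eq: "abs_twin (s # w) = abs_twin (w @ [s])"
      using w(3) by (simp add: abs_twin_simps)
    have "red (w @ [s])"
      using red_if_len[of "w @ [s]"] len_abs_twin[OF sw] eq by simp
    then have teq: "teq (s # w) (w @ [s])" using eq abs_twin_eq_iff sw by blast
    have dep_s: "t = s" if "dep s t" "t \<in> set w" for t
    proof -
      have "proj s t (s # w) = proj s t (w @ [s])" using teq \<open>dep s t\<close> unfolding teq_def by blast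
      then have "s # proj s t w = proj s t w @ [s]" by simp
      from Cons_eq_snoc_imp[OF this] show ?thesis using that by auto
    qed
    then have "s \<notin> set w" using dep_only_self_imp_desc w(2) by blast
    then show ?thesis using dep_s w(4) by blast
  qed
  obtain w where w: "red w" "x = abs_twin w" by (rule red_repE)
  show ?thesis
  proof (cases "desc s w")
    case False
    then show ?thesis using * w comm t by (simp add: supp_abs_twin)
  next
    case True
    let ?w = "remove1 s w"
    have teq: "teq w (s # ?w)" by (rule desc_imp_teq[OF True])
    then have red: "red (s # ?w)" using w(1) red_teq by blast
    then have x: "x = tgen s + abs_twin ?w"
      using w teq abs_twin_eq_iff by (metis abs_twin_simps(2))
    then have "tgen s + abs_twin ?w = abs_twin ?w + tgen s"
      using comm by (simp add: add.assoc) (metis add.assoc tgen_add_tgen_left)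
    then have "\<forall>t\<in>set ?w. \<not> dep s t" using * red by auto
    then have "s \<notin> set ?w" by auto
    then have "\<not> par s (abs_twin ?w)"
      using par_imp_supp supp_abs_twin_subset by blast
    then show ?thesis using par x by simp
  qed
qed

section \<open>Involutions\<close>

text \<open>As \<open>x\<close> is its own inverse, the reversed word is again a reduced word of
  \<open>x\<close>, so \<open>s\<close> can be moved to either end. Either a single \<open>s\<close>
  serves both ends and commutes with all letters, or two occurrences split off and leave a shorter
  element.\<close>

lemma involution_desc_cases:
  assumes x: "x = abs_twin w" "red w" "x + x = 0" and d: "desc s w"
  obtains (central) "par s x" "\<And>t. t \<in> supp x \<Longrightarrow> t = s \<or> \<not> dep s t"
    | (conj) y where "x = tgen s + y + tgen s" "len x = len y + 2" "supp y \<subseteq> supp x"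
proof -
  define v where "v = remove1 s w"
  have "abs_twin (rev w) = abs_twin w"
    using x minus_unique by (metis abs_twin_simps(4))
  moreover have "red (rev w)"
    using red_if_len[of "rev w"] len_abs_twin x calculation by simp
  ultimately have rev: "teq (rev w) w" using abs_twin_eq_iff x by blast
  have sw: "teq w (s # v)" unfolding v_def by (rule desc_imp_teq[OF d])
  have ws: "teq w (rev v @ [s])" using teq_trans[OF teq_sym[OF rev] teq_rev[OF sw]] by simp
  have proj: "s # proj s t v = rev (proj s t v) @ [s]" if "dep s t" for t
  proof -
    have "proj s t (s # v) = proj s t (rev v @ [s])"
      using teq_trans[OF teq_sym[OF sw] ws] that unfolding teq_def by blast
    then show ?thesis by simp
  qed
  show thesis
  proof (cases "s \<in> set v")
    case False
    have "\<not> dep s t" if "t \<in> set v" for t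
    proof
      assume dep: "dep s t"
      have "s \<notin> set (rev (proj s t v))" using False by simp
      \<comment> \<open>A nonempty \<open>rev (proj s t v)\<close> would have to start with
        \<open>s\<close>.\<close>
      then have "proj s t v = []"
        using proj[OF dep] by (cases "rev (proj s t v)") auto
      then show False using that by (auto simp flip: set_empty)
    qed
    moreover have "set w = insert s (set v)" using teq_set[OF sw] by simp
    moreover have "par s x"
      using False teq_count[OF sw, of s] x by (simp add: par.abs_eq count_list_0_iff)
    ultimately show thesis using central x by (auto simp: supp_abs_twin)
  next
    case True
    \<comment> \<open>\<open>u\<close> is \<open>v\<close> without its last occurrence of
      \<open>s\<close>.\<close>
    define u where "u = rev (remove1 s (rev v))"
    have "desc s (rev v)"
      unfolding desc_iff_proj
    proof (intro allI impI)
      fix t assume dep: "dep s t"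
      have "proj s t v \<noteq> []" using True by (auto simp flip: set_empty)
      then show "\<exists>ys. proj s t (rev v) = s # ys"
        using proj[OF dep] by (cases "rev (proj s t v)") auto
    qed
    then have "teq (rev v) (s # rev u)" unfolding u_def rev_rev_ident by (rule desc_imp_teq)
    then have w': "teq v (u @ [s])" using teq_rev by fastforce
    then have "teq (s # v) (s # u @ [s])" by simp
    with sw have w: "teq w (s # u @ [s])" by (rule teq_trans)
    then have red: "red (s # u @ [s])" using x red_teq by blast
    then have red_u: "red u" using red_appendD1 by auto
    have xu: "x = tgen s + abs_twin u + tgen s"
      using w red abs_twin_eq_iff[of w "s # u @ [s]"] x
      by (simp add: abs_twin_simps add.assoc)
    moreover have "len x = len (abs_twin u) + 2"
      using x teq_length[OF w] red_u by (simp add: len_abs_twin)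
    moreover have "supp (abs_twin u) \<subseteq> supp x"
      using x teq_set[OF w] supp_abs_twin_subset[of "u"] by (auto simp: supp_abs_twin)
    ultimately show thesis by (rule conj)
  qed
qed

lemma tgen_conj_involution: "x = tgen s + y + tgen s \<Longrightarrow> x + x = 0 \<Longrightarrow> y + y = 0"
proof -
  assume "x = tgen s + y + tgen s" "x + x = 0"
  then have "tgen s + (y + y) + tgen s = 0" by (simp add: add.assoc)
  then have "tgen s + (tgen s + (y + y) + tgen s) + tgen s = tgen s + 0 + tgen s" by simp
  then show ?thesis by (simp add: add.assoc)
qed

text \<open>Conjugating by the first letter shortens the involution and keeps all parities. The
  central case would make a parity odd.\<close>

lemma even_involution:
  "x + x = 0 \<Longrightarrow> \<forall>s. \<not> par s x \<Longrightarrow> x = 0"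
proof (induction x rule: measure_induct_rule[of len])
  case (less x)
  obtain w where w: "red w" "x = abs_twin w" by (rule red_repE)
  show ?case
  proof (cases w)
    case Nil
    then show ?thesis using w by (simp add: abs_twin_simps)
  next
    case (Cons s v)
    then have "desc s w" by simp
    with w(2,1) less.prems(1) show ?thesis
    proof (cases rule: involution_desc_cases)
      case (conj y)
      have "y + y = 0" using tgen_conj_involution[OF conj(1) less.prems(1)] .
      moreover have "par t x \<longleftrightarrow> par t y" for t unfolding conj(1) by auto
      then have "\<forall>s. \<not> par s y" using less.prems(2) by simp
      ultimately have "y = 0" using less.IH[of y] conj(2) by simp
      then show ?thesis using conj(1) by simp
    qed (use less.prems(2) in auto)
  qed
qed

text \<open>In the central case the first letter is \<open>i\<close>, and \<open>tgen i + x\<close>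
  is an involution with even parities, hence trivial. Otherwise a conjugate is shorter.\<close>

lemma odd_involution:
  "x + x = 0 \<Longrightarrow> \<forall>s. par s x \<longleftrightarrow> s = i \<Longrightarrow> \<exists>h. x = h + tgen i - h"
proof (induction x rule: measure_induct_rule[of len])
  case (less x)
  obtain w where w: "red w" "x = abs_twin w" by (rule red_repE)
  have "w \<noteq> []" using less.prems(2) w by (auto simp: abs_twin_simps)
  then have "desc (hd w) w" by (cases w) auto
  with w(2,1) less.prems(1) show ?case
  proof (cases rule: involution_desc_cases)
    case central
    then have i: "hd w = i" using less.prems(2) by simp
    have comm: "tgen i + x = x + tgen i"
      by (rule tgen_commute_supp) (use central i in blast)
    have "(tgen i + x) + (tgen i + x) = (x + tgen i) + (tgen i + x)"
      by (simp only: comm)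
    also have "\<dots> = 0" using less.prems(1) by (simp add: add.assoc)
    finally have "tgen i + x = 0"
      by (rule even_involution) (use less.prems(2) in auto)
    then have "x = 0 + tgen i - 0" using minus_unique[of "tgen i" x] by simp
    then show ?thesis by blast
  next
    case (conj y)
    let ?s = "tgen (hd w)"
    have "y + y = 0" using tgen_conj_involution[OF conj(1) less.prems(1)] .
    moreover have "par t x \<longleftrightarrow> par t y" for t unfolding conj(1) by auto
    then have "\<forall>s. par s y \<longleftrightarrow> s = i" using less.prems(2) by simp
    ultimately obtain h where y: "y = h + tgen i - h" using less.IH[of y] conj(2) by auto
    then have "x = (?s + h) + tgen i - (?s + h)"
      by (simp only: conj(1) y diff_conv_add_uminus minus_add minus_tgen add.assoc)
    then show ?thesis by blast
  qed
qed

section \<open>Generation\<close>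

text \<open>The sets \<open>X\<close> to which this is applied below consist of involutions, so the
  generated submonoid is already the generated subgroup.\<close>

inductive_set cl :: "'a::monoid_add set \<Rightarrow> 'a set" for X where
  zero: "0 \<in> cl X"
| step: "x \<in> X \<Longrightarrow> y \<in> cl X \<Longrightarrow> x + y \<in> cl X"

lemma cl_base: "x \<in> X \<Longrightarrow> x \<in> cl X"
  using cl.step[OF _ cl.zero] by fastforce

lemma cl_add: "x \<in> cl X \<Longrightarrow> y \<in> cl X \<Longrightarrow> x + y \<in> cl X"
  by (induction rule: cl.induct) (auto simp: add.assoc intro: cl.step)

lemma cl_hom:
  assumes "x \<in> cl X" "f 0 = 0" "\<And>x y. f (x + y) = f x + f y" "\<And>y. y \<in> X \<Longrightarrow> f y \<in> cl Y"
  shows "f x \<in> cl Y"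
  using assms(1) by induction (auto simp: assms intro: cl.zero cl_add)

lemma cl_conj:
  fixes x :: "'a::group_add"
  assumes "x \<in> cl X"
  shows "- h + x + h \<in> cl ((\<lambda>y. - h + y + h) ` X)"
  by (rule cl_hom[OF assms]) (auto simp: add.assoc intro: cl_base)

section \<open>Subgroups of a free product\<close>

text \<open>The group generated by \<open>A\<close> and \<open>b\<close> is the free product of the group generated by \<open>A\<close> and
  the group of order two generated by \<open>b\<close>.  A reduced word \<open>r\<close> that begins and ends with \<open>b\<close>
  does not cancel against reduced words in \<open>A\<close>, so that every element generated by \<open>A\<close> and \<open>r\<close> has
  a normal form containing full copies of \<open>r\<close>.  The proviso \<open>a \<noteq> [] \<or> p = []\<close> excludes
  two adjacent copies of \<open>r\<close>.\<close>

inductive_set alternating :: "nat set \<Rightarrow> nat list \<Rightarrow> nat list set" for A r where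
  Nil: "[] \<in> alternating A r"
| step: "p \<in> alternating A r \<Longrightarrow> set a \<subseteq> A \<Longrightarrow> red a \<Longrightarrow> a \<noteq> [] \<or> p = []
    \<Longrightarrow> r @ a @ p \<in> alternating A r"

locale free_factor =
  fixes A :: "nat set" and b :: nat and r q :: "nat list"
  assumes A: "\<And>x. x \<in> A \<Longrightarrow> dep x b \<and> x \<noteq> b"
    and r: "red (q @ [b])" "r = q @ [b]" "hd r = b" "set r \<subseteq> insert b A"
begin

lemma r_Cons: "\<exists>q. r = b # q"
  using r(2,3) by (cases q) auto

text \<open>Each copy of \<open>r\<close> ends in \<open>b\<close>, past which no letter of
  \<open>r\<close> or \<open>A\<close> can move, and the block \<open>a\<close> separates this
  \<open>b\<close> from the first letter of the next copy.\<close>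

lemma alternating_red:
  "p \<in> alternating A r \<Longrightarrow> red p \<and> (p = [] \<or> (\<exists>q. p = b # q))"
proof (induction rule: alternating.induct)
  case (step p a)
  have desc: "\<not> desc x p" if "x \<in> A" for x
    using step A[OF that] by auto
  then have "red (a @ p)" using step by (intro red_append) auto
  moreover have "\<not> desc b (a @ p)"
  proof (cases a)
    case (Cons c a')
    then have "dep b c" "c \<noteq> b" using A[of c] step dep_sym by auto
    then show ?thesis using Cons by simp
  qed (use step in auto)
  ultimately have "red (b # (a @ p))" by simp
  moreover have "\<forall>x\<in>set q. dep x b"
  proof
    fix x assume "x \<in> set q"
    then have "x \<in> insert b A" using r(4) unfolding r(2) by auto
    then show "dep x b" using A[of x] by auto
  qed
  ultimately have "red (q @ b # (a @ p))" using red_append_dep[OF r(1)] by blast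
  then have "red (r @ a @ p)" by (simp add: r(2))
  then show ?case using r_Cons by auto
qed simp

lemma red_append_alternating:
  assumes "p \<in> alternating A r" "set a \<subseteq> A" "red a"
  shows "red (a @ p)"
  using alternating_red[OF assms(1)] assms A by (intro red_append) auto

text \<open>Left multiplication by a letter of \<open>A\<close> changes only the leading block
  \<open>a\<close>. Left multiplication by \<open>r\<close> adds a copy of \<open>r\<close>, or
  cancels the leading copy if no letter stands before it.\<close>

lemma cl_normal_form:
  assumes "y \<in> cl (insert (abs_twin r) (tgen ` A))" and rr: "abs_twin r + abs_twin r = 0"
  shows "\<exists>a p. set a \<subseteq> A \<and> red a \<and> p \<in> alternating A r \<and> y = abs_twin (a @ p)"
  using assms(1)
proof induction
  case zero
  then show ?case using alternating.Nil
    by (intro exI[of _ "[]"]) (simp add: abs_twin_simps)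
next
  case (step x y)
  then obtain a p where ap: "set a \<subseteq> A" "red a" "p \<in> alternating A r" "y = abs_twin (a @ p)"
    by blast
  show ?case
  proof (cases "x = abs_twin r")
    case True
    show ?thesis
    proof (cases "a = [] \<and> p \<noteq> []")
      case False
      then have "r @ a @ p \<in> alternating A r" using ap by (intro alternating.step) auto
      then show ?thesis using True ap
        by (intro exI[of _ "[]"] exI[of _ "r @ a @ p"]) (simp add: abs_twin_simps)
    next
      case *: True
      from ap(3) * obtain a' p' where "p = r @ a' @ p'" "set a' \<subseteq> A" "red a'" "p' \<in> alternating A r"
        by (cases rule: alternating.cases) auto
      moreover have "x + y = abs_twin (a' @ p')"
        using calculation True rr ap(4) * by (simp add: abs_twin_simps flip: add.assoc)
      ultimately show ?thesis by blast
    qed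
  next
    case False
    then obtain c where c: "x = tgen c" "c \<in> A" using step by auto
    have "red (act c a)" "set (act c a) \<subseteq> A" using ap c red_act set_act[of c a] by auto
    moreover have "abs_twin (c # a) = abs_twin (act c a)"
      using ap(2) calculation by (simp add: twin.abs_eq_iff tw_eq_def)
    then have "x + y = abs_twin (act c a @ p)"
      using c ap by (simp add: abs_twin_simps flip: add.assoc)
    ultimately show ?thesis using ap(3) by blast
  qed
qed

text \<open>The normal form of \<open>tgen b\<close> has length one, yet it contains a full copy of
  \<open>r\<close>, because \<open>b\<close> is not in \<open>A\<close>.\<close>

lemma length_r_eq_1:
  assumes "tgen b \<in> cl (insert (abs_twin r) (tgen ` A))" and "abs_twin r + abs_twin r = 0"
  shows "r = [b]"
proof -
  obtain a p where ap: "set a \<subseteq> A" "red a" "p \<in> alternating A r" "tgen b = abs_twin (a @ p)"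
    using cl_normal_form[OF assms] by blast
  have "abs_twin [b] = abs_twin (a @ p)" using ap by (simp add: abs_twin_simps)
  then have teq: "teq [b] (a @ p)"
    using red_append_alternating[of p a] ap abs_twin_eq_iff[of "[b]" "a @ p"] by simp
  have "a = []" using teq_set[OF teq] ap(1) A by (cases a) auto
  then have "length p = 1" using teq_length[OF teq] by simp
  with ap(3) have "length r \<le> 1"
    by (cases rule: alternating.cases) auto
  then show ?thesis using r by (cases q) auto
qed

end

text \<open>Conjugating by a letter of \<open>A\<close> that can be moved to the front shortens
  \<open>x\<close> and keeps the generation hypothesis. Without such a letter
  \<open>length_r_eq_1\<close> applies. The bound by \<open>supp x\<close> makes the conjugator
  commute with distant generators later on.\<close>

lemma free_product_conj:
  assumes A: "\<And>x. x \<in> A \<Longrightarrow> dep x b \<and> x \<noteq> b"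
  shows "x + x = 0 \<Longrightarrow> \<forall>s. par s x \<longleftrightarrow> s = b \<Longrightarrow> supp x \<subseteq> insert b A
    \<Longrightarrow> tgen b \<in> cl (insert x (tgen ` A))
    \<Longrightarrow> \<exists>a. supp a \<subseteq> supp x \<inter> A \<and> x = a + tgen b - a"
proof (induction x rule: measure_induct_rule[of len])
  case (less x)
  obtain w where w: "red w" "x = abs_twin w" by (rule red_repE)
  show ?case
  proof (cases "\<exists>c\<in>A. desc c w")
    case True
    then obtain c where c: "c \<in> A" "desc c w" by blast
    from w(2,1) less.prems(1) c(2) show ?thesis
    proof (cases rule: involution_desc_cases)
      case central
      \<comment> \<open>Parity excludes this case, as \<open>c\<close> differs from
        \<open>b\<close>.\<close>
      then show ?thesis using less.prems(2) A[OF c(1)] by auto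
    next
      case (conj y)
      have 1: "y + y = 0" using tgen_conj_involution[OF conj(1) less.prems(1)] .
      have "par t x \<longleftrightarrow> par t y" for t unfolding conj(1) by auto
      then have 2: "\<forall>s. par s y \<longleftrightarrow> s = b" using less.prems(2) by simp
      have 3: "supp y \<subseteq> insert b A" using conj(3) less.prems(3) by blast
      have "x \<in> cl (insert y (tgen ` A))"
        unfolding conj(1) using c by (intro cl_add cl_base) auto
      then have 4: "tgen b \<in> cl (insert y (tgen ` A))"
        by (intro cl_hom[OF less.prems(4), of "\<lambda>z. z"]) (auto intro: cl_base)
      obtain a where a: "supp a \<subseteq> supp y \<inter> A" "y = a + tgen b - a"
        using less.IH[OF _ 1 2 3 4] conj(2) by auto
      have "x = (tgen c + a) + tgen b - (tgen c + a)"
        by (simp only: conj(1) a(2) diff_conv_add_uminus minus_add minus_tgen add.assoc)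
      moreover have "c \<in> supp x"
        using desc_imp_mem[OF c(2)] w by (simp add: supp_abs_twin)
      then have "supp (tgen c + a) \<subseteq> supp x \<inter> A"
        using a(1) c(1) conj(3) by (intro supp_add_subset) auto
      ultimately show ?thesis by blast
    qed
  next
    case False
    have "b \<in> set w"
      using less.prems(2) par_imp_supp[of b x] w by (simp add: supp_abs_twin)
    then have ne: "w \<noteq> []" by auto
    have set_w: "set w \<subseteq> insert b A" using less.prems(3) w by (simp add: supp_abs_twin)
    have "abs_twin (rev w) = abs_twin w"
      using less.prems(1) w minus_unique by (metis abs_twin_simps(4))
    moreover have "red (rev w)"
      using red_if_len[of "rev w"] len_abs_twin w calculation by simp
    ultimately have rev: "teq (rev w) w" using abs_twin_eq_iff w by blast
    \<comment> \<open>Used for \<open>w\<close> and for its reversal, this shows that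
      \<open>w\<close> begins and ends with \<open>b\<close>.\<close>
    have hd: "hd v = b" if "v \<noteq> []" "teq v w" for v
    proof -
      have "desc (hd v) v" using that by (cases v) auto
      then have "desc (hd v) w" using desc_teq[OF that(2)] by simp
      then show ?thesis using False desc_imp_mem set_w by blast
    qed
    have "hd w = b" "last w = b"
      using hd[of w] hd[of "rev w"] rev ne by (auto simp: hd_rev)
    then have wq: "w = butlast w @ [b]" using append_butlast_last_id[OF ne] by simp
    interpret free_factor A b w "butlast w"
      by unfold_locales (use A w(1) set_w \<open>hd w = b\<close> wq in \<open>simp_all flip: wq\<close>)
    have "w = [b]" using length_r_eq_1 less.prems(1,4) w by simp
    then have "x = 0 + tgen b - 0" using w by (simp add: abs_twin_simps)
    then show ?thesis by (intro exI[of _ 0]) simp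
  qed
qed

lemma conj_add: "(h + x - h) + (h + y - h) = h + (x + y) - h" for h :: "'a::group_add"
  by (simp add: diff_conv_add_uminus add.assoc del: add_uminus_conv_diff)

section \<open>Simultaneous conjugation\<close>

text \<open>The generation hypothesis has to be carried through the induction: without it,
  \<open>R (k + 1)\<close> need not be conjugate to its generator by an element of the first
  factor.\<close>

lemma simultaneous_conjugation:
  fixes R :: "nat \<Rightarrow> twin" and k d :: nat
  defines "I \<equiv> {k..<k + d}"
  assumes "\<And>i. i \<in> I \<Longrightarrow> \<exists>h. R i = h + tgen i - h"
    and "\<And>i. i \<in> I \<Longrightarrow> supp (R i) \<subseteq> I"
    and "\<And>i j. i \<in> I \<Longrightarrow> j \<in> I \<Longrightarrow> \<not> dep i j \<Longrightarrow> R i + R j = R j + R i"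
    and "\<And>x. supp x \<subseteq> I \<Longrightarrow> x \<in> cl (R ` I)"
  shows "\<exists>h. supp h \<subseteq> I \<and> (\<forall>i\<in>I. R i = h + tgen i - h)"
  using assms(2-) unfolding I_def
proof (induction d arbitrary: k R rule: less_induct)
  case (less d)
  define I where "I = {k..<k + d}"
  note conj = less.prems(1)[folded I_def] and supp = less.prems(2)[folded I_def]
    and comm = less.prems(3)[folded I_def] and gen = less.prems(4)[folded I_def]
  show ?case
  proof (cases "d = 0")
    case True
    then show ?thesis by (intro exI[of _ 0]) simp
  next
    case False
    then have k: "k \<in> I" by (simp add: I_def)
    \<comment> \<open>The form required by the induction hypothesis; truncated subtraction makes the
      interval empty for \<open>d = 1\<close>.\<close>
    define I2 where "I2 = {k + 2..<k + 2 + (d - 2)}"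
    have I2: "i \<in> I2 \<longleftrightarrow> i \<in> I \<and> \<not> dep k i" for i
      by (auto simp: I2_def I_def dep_def)
    obtain h where h: "R k = h + tgen k - h" using conj[OF k] by blast
    \<comment> \<open>The conjugator may leave \<open>I\<close>. The retraction fixes
      \<open>R k\<close> and \<open>tgen k\<close>, so the retracted conjugator serves as
      well.\<close>
    define h1 where "h1 = ret I h"
    have h1_supp: "supp h1 \<subseteq> I" unfolding h1_def by (rule supp_ret)
    have "ret I (R k) = R k" using supp[OF k] by (rule ret_id)
    then have h1: "R k = h1 + tgen k - h1" using h k by (simp add: h1_def)
    define R1 where "R1 = (\<lambda>i. - h1 + R i + h1)"
    have R1_k: "R1 k = tgen k" using h1 by (simp add: R1_def add.assoc)
    have R1_conj: "\<exists>h. R1 i = h + tgen i - h" if i: "i \<in> I" for i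
    proof -
      obtain g where g: "R i = g + tgen i - g" using conj[OF i] by blast
      have "R1 i = (- h1 + g) + tgen i - (- h1 + g)"
        by (simp only: R1_def g diff_conv_add_uminus minus_add minus_minus add.assoc)
      then show ?thesis by blast
    qed
    have R1_supp: "supp (R1 i) \<subseteq> I" if "i \<in> I" for i
      unfolding R1_def using supp[OF that] h1_supp by (intro supp_add_subset supp_minus_subset)
    have R1_comm: "R1 i + R1 j = R1 j + R1 i" if "i \<in> I" "j \<in> I" "\<not> dep i j" for i j
    proof -
      have "R1 i + R1 j = - h1 + (R i + R j) + h1" by (simp add: R1_def add.assoc)
      also have "\<dots> = - h1 + (R j + R i) + h1" by (simp only: comm[OF that])
      also have "\<dots> = R1 j + R1 i" by (simp add: R1_def add.assoc)
      finally show ?thesis .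
    qed
    have R1_gen: "x \<in> cl (R1 ` I)" if "supp x \<subseteq> I" for x
    proof -
      have "h1 + x + - h1 \<in> cl (R ` I)"
        using gen that h1_supp by (intro gen supp_add_subset supp_minus_subset)
      then have "- h1 + (h1 + x + - h1) + h1 \<in> cl ((\<lambda>y. - h1 + y + h1) ` R ` I)"
        by (rule cl_conj)
      then show ?thesis by (simp add: add.assoc image_image R1_def)
    qed
    have R1_par: "par s (R1 i) \<longleftrightarrow> s = i" if "i \<in> I" for s i
      using R1_conj[OF that] by auto
    have "\<exists>h. supp h \<subseteq> I2 \<and> (\<forall>i\<in>I2. R1 i = h + tgen i - h)"
      unfolding I2_def
    proof (rule less.IH, fold I2_def)
      show "d - 2 < d" using False by simp
      show "\<exists>h. R1 i = h + tgen i - h" if "i \<in> I2" for i using that R1_conj I2 by blast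
      show I2_supp: "supp (R1 i) \<subseteq> I2" if "i \<in> I2" for i
      proof
        fix t assume t: "t \<in> supp (R1 i)"
        have "tgen k + R1 i = R1 i + tgen k" using R1_comm[OF k, of i] that I2 R1_k by auto
        moreover have "\<not> par k (R1 i)" using R1_par[of i k] that I2[of i] by auto
        ultimately have "\<not> dep k t" using t by (rule supp_centralizer)
        then show "t \<in> I2" using t R1_supp[of i] that I2 by auto
      qed
      show "R1 i + R1 j = R1 j + R1 i" if "i \<in> I2" "j \<in> I2" "\<not> dep i j" for i j
        using that R1_comm I2 by blast
      show "x \<in> cl (R1 ` I2)" if x: "supp x \<subseteq> I2" for x
      proof -
        have "x \<in> cl (R1 ` I)" using x I2 by (intro R1_gen) auto
        \<comment> \<open>The retraction fixes \<open>R1 i\<close> for \<open>i\<close> in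
          \<open>I2\<close> and kills the other \<open>R1 i\<close>, which are conjugates of
          generators outside \<open>I2\<close>.\<close>
        then have "ret I2 x \<in> cl (R1 ` I2)"
        proof (rule cl_hom)
          fix y assume "y \<in> R1 ` I"
          then obtain i where i: "i \<in> I" "y = R1 i" by blast
          show "ret I2 y \<in> cl (R1 ` I2)"
          proof (cases "i \<in> I2")
            case True
            then show ?thesis using i I2_supp[OF True] ret_id by (auto intro: cl_base)
          next
            case False
            then show ?thesis using R1_conj[OF i(1)] i(2) by (auto intro: cl.zero)
          qed
        qed auto
        then show ?thesis using ret_id[OF x] by simp
      qed
    qed
    then obtain h2 where h2_supp: "supp h2 \<subseteq> I2"
      and h2: "\<And>i. i \<in> I2 \<Longrightarrow> R1 i = h2 + tgen i - h2" by blast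
    define R2 where "R2 = (\<lambda>i. - h2 + R1 i + h2)"
    have h2_comm: "tgen k + h2 = h2 + tgen k"
      by (rule tgen_commute_supp) (use h2_supp I2 in blast)
    have R2_gen_k: "R2 k = tgen k"
      using h2_comm by (simp add: R2_def R1_k add.assoc)
    have R2_gen: "R2 i = tgen i" if "i \<in> I2" for i
      using h2[OF that] by (simp add: R2_def add.assoc)
    have h2_supp_I: "supp h2 \<subseteq> I" using h2_supp I2 by blast
    have "\<exists>a. supp a \<subseteq> I \<and> (\<forall>i\<in>I. R2 i = a + tgen i - a)"
    proof (cases "d = 1")
      case True
      then have "I = {k}" by (auto simp: I_def)
      then show ?thesis using R2_gen_k by (intro exI[of _ 0]) simp
    next
      case d: False
      define b where "b = k + 1"
      \<comment> \<open>These are the letters that depend on \<open>b\<close> and exceed or precede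
        it within \<open>I\<close>; for \<open>d = 2\<close> the letter \<open>k + 2\<close> lies
        outside \<open>I\<close>, but the conjugator found below uses only letters of
        \<open>x\<close>.\<close>
      define A where "A = {k, k + 2}"
      have b: "b \<in> I" using False d by (simp add: I_def b_def)
      define x where "x = R2 b"
      have I_eq: "i \<in> I \<longleftrightarrow> i = k \<or> i = b \<or> i \<in> I2" for i
        using False d by (auto simp: b_def I_def I2_def)
      obtain g where "R1 b = g + tgen b - g" using R1_conj[OF b] by blast
      then have x_conj: "x = (- h2 + g) + tgen b - (- h2 + g)"
        by (simp only: x_def R2_def diff_conv_add_uminus minus_add minus_minus add.assoc)
      have x_invol: "x + x = 0" unfolding x_conj conj_add by simp
      have x_par: "par s x \<longleftrightarrow> s = b" for s unfolding x_conj by auto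
      have x_supp_I: "supp x \<subseteq> I"
        unfolding x_def R2_def using R1_supp[OF b] h2_supp_I
        by (intro supp_add_subset supp_minus_subset)
      have x_indep: "\<not> dep j t" if j: "j \<in> I" "k + 3 \<le> j" and t: "t \<in> supp x" for j t
      proof -
        have jb: "\<not> dep j b" and j2: "j \<in> I2" and "j \<noteq> b" using j I2 by (auto simp: b_def dep_def)
        have "R2 j + R2 b = - h2 + (R1 j + R1 b) + h2" by (simp add: R2_def add.assoc)
        also have "\<dots> = R2 b + R2 j" by (simp add: R1_comm j b jb R2_def add.assoc)
        finally have "tgen j + x = x + tgen j" using R2_gen[OF j2] by (simp add: x_def)
        moreover have "\<not> par j x" using x_par \<open>j \<noteq> b\<close> by simp
        ultimately show ?thesis using t by (rule supp_centralizer)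
      qed
      have x_supp: "supp x \<subseteq> insert b A"
      proof
        fix t assume t: "t \<in> supp x"
        then have "t \<in> I" using x_supp_I by blast
        \<comment> \<open>As \<open>t\<close> depends on itself, \<open>x_indep\<close> with
          \<open>j = t\<close> rules out \<open>t \<ge> k + 3\<close>.\<close>
        then show "t \<in> insert b A" using x_indep[of t t] t
          by (force simp: A_def b_def I_def)
      qed
      have x_gen: "tgen b \<in> cl (insert x (tgen ` A))"
      proof -
        have "h2 + tgen b + - h2 \<in> cl (R1 ` I)"
          using b h2_supp_I by (intro R1_gen supp_add_subset supp_minus_subset) auto
        then have "- h2 + (h2 + tgen b + - h2) + h2 \<in> cl ((\<lambda>y. - h2 + y + h2) ` R1 ` I)"
          by (rule cl_conj)
        then have "tgen b \<in> cl (R2 ` I)" by (simp add: add.assoc image_image R2_def)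
        \<comment> \<open>The retraction kills the generators beyond \<open>k + 2\<close> and fixes
          \<open>x\<close>.\<close>
        then have "ret (insert b A) (tgen b) \<in> cl (insert x (tgen ` A))"
        proof (rule cl_hom)
          fix y assume "y \<in> R2 ` I"
          then obtain i where i: "i \<in> I" "y = R2 i" by blast
          consider "i = b" | "i \<noteq> b" "R2 i = tgen i" using i(1) I_eq R2_gen R2_gen_k by metis
          then show "ret (insert b A) y \<in> cl (insert x (tgen ` A))"
          proof cases
            case 1
            then have "ret (insert b A) y = x" using i ret_id[OF x_supp] by (simp add: x_def)
            then show ?thesis by (auto intro: cl_base)
          next
            case 2
            then show ?thesis using i by (auto intro: cl_base cl.zero)
          qed
        qed auto
        then show ?thesis by simp
      qed
      have "dep c b \<and> c \<noteq> b" if "c \<in> A" for c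
        using that by (auto simp: A_def b_def dep_def)
      from free_product_conj[OF this x_invol _ x_supp x_gen]
      obtain a where a: "supp a \<subseteq> supp x \<inter> A" "x = a + tgen b - a" using x_par by blast
      have "R2 i = a + tgen i - a" if i: "i \<in> I" for i
      proof (cases "i = b")
        case True
        then show ?thesis using a by (simp add: x_def)
      next
        case False
        \<comment> \<open>The letters \<open>k\<close> and \<open>k + 2\<close> commute with each
          other. For larger \<open>i\<close>, \<open>x_indep\<close> applies because the letters of
          \<open>a\<close> are letters of \<open>x\<close>.\<close>
        have "\<forall>t\<in>supp a. t = i \<or> \<not> dep i t"
        proof
          fix t assume t: "t \<in> supp a"
          then have t': "t \<in> supp x" "t = k \<or> t = k + 2" using a(1) by (auto simp: A_def)
          consider "i = k" | "i = k + 2" | "k + 3 \<le> i"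
            using False i by (force simp: b_def I_def)
          then show "t = i \<or> \<not> dep i t"
            using t' x_indep[OF i _ t'(1)] by cases (auto simp: dep_def)
        qed
        then have "tgen i + a = a + tgen i" by (rule tgen_commute_supp)
        then have "a + tgen i - a = tgen i" by (metis add_diff_cancel)
        then show ?thesis using False I_eq i R2_gen R2_gen_k by metis
      qed
      moreover have "supp a \<subseteq> I" using a(1) x_supp_I by blast
      ultimately show ?thesis by blast
    qed
    then obtain a where a_supp: "supp a \<subseteq> I" and a: "\<And>i. i \<in> I \<Longrightarrow> R2 i = a + tgen i - a"
      by blast
    let ?h = "h1 + h2 + a"
    have "supp ?h \<subseteq> I" using h1_supp h2_supp_I a_supp by (intro supp_add_subset)
    moreover have "R i = ?h + tgen i - ?h" if "i \<in> I" for i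
    proof -
      have "R i = h1 + (h2 + R2 i + - h2) + - h1"
        by (simp add: R2_def R1_def add.assoc del: add_uminus_conv_diff)
      also have "\<dots> = ?h + tgen i - ?h"
        by (simp only: a[OF that] diff_conv_add_uminus minus_add add.assoc)
      finally show ?thesis .
    qed
    ultimately show ?thesis unfolding I_def by blast
  qed
qed

section \<open>Embedding of the twin group on finitely many generators\<close>

definition tw_cls :: "nat \<Rightarrow> nat word \<Rightarrow> nat word set" where
  "tw_cls n w = pres_cong {1..n - 1} (twin_relations n) `` {w}"

abbreviation tw_gen :: "nat \<Rightarrow> nat \<Rightarrow> nat word set" where
  "tw_gen n i \<equiv> tw_cls n [gen i]"

lemma tw_cls_eqI: "(u, v) \<in> pres_cong {1..n - 1} (twin_relations n) \<Longrightarrow> tw_cls n u = tw_cls n v"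
  unfolding tw_cls_def by (rule equiv_class_eq[OF equiv_pres_cong])

lemma twin_group_carrier: "carrier (twin_group n) = tw_cls n ` words {1..n - 1}"
  by (auto simp: twin_group_def presented_group_carrier tw_cls_def)

lemma tw_cls_carrier: "w \<in> words {1..n - 1} \<Longrightarrow> tw_cls n w \<in> carrier (twin_group n)"
  by (simp add: twin_group_carrier)

lemma tw_cls_mult:
  "u \<in> words {1..n - 1} \<Longrightarrow> v \<in> words {1..n - 1} \<Longrightarrow>
    tw_cls n u \<otimes>\<^bsub>twin_group n\<^esub> tw_cls n v = tw_cls n (u @ v)"
  by (simp add: twin_group_def tw_cls_def presented_group_mult)

lemma tw_cls_Nil: "tw_cls n [] = \<one>\<^bsub>twin_group n\<^esub>"
  by (simp add: twin_group_def tw_cls_def presented_group_one)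

lemma tw_gen_carrier: "i \<in> {1..n - 1} \<Longrightarrow> tw_gen n i \<in> carrier (twin_group n)"
  by (rule tw_cls_carrier) simp

lemma tw_gen_square:
  assumes "i \<in> {1..n - 1}"
  shows "tw_gen n i \<otimes>\<^bsub>twin_group n\<^esub> tw_gen n i = \<one>\<^bsub>twin_group n\<^esub>"
proof -
  have "([gen i, gen i], []) \<in> pres_cong {1..n - 1} (twin_relations n)"
    using assms by (intro pres_cong.relation) (auto simp: twin_relations_def)
  from tw_cls_eqI[OF this] show ?thesis using assms by (simp add: tw_cls_mult tw_cls_Nil)
qed

lemma tw_gen_commute:
  assumes "i \<in> {1..n - 1}" "j \<in> {1..n - 1}" "\<not> dep i j"
  shows "tw_gen n i \<otimes>\<^bsub>twin_group n\<^esub> tw_gen n j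
    = tw_gen n j \<otimes>\<^bsub>twin_group n\<^esub> tw_gen n i"
proof -
  have "\<bar>int i - int j\<bar> \<ge> 2" using assms(3) by (auto simp: dep_def)
  then have "([gen i, gen j], [gen j, gen i]) \<in> pres_cong {1..n - 1} (twin_relations n)"
    using assms(1,2) by (intro pres_cong.relation) (auto simp: twin_relations_def)
  from tw_cls_eqI[OF this] show ?thesis using assms(1,2) by (simp add: tw_cls_mult)
qed

text \<open>The sign \<open>b\<close> disappears because each generator is its own inverse.\<close>

lemma tw_cls_Cons:
  assumes "i \<in> {1..n - 1}" "w \<in> words {1..n - 1}"
  shows "tw_cls n ((i, b) # w) = tw_gen n i \<otimes>\<^bsub>twin_group n\<^esub> tw_cls n w"
proof -
  interpret group "twin_group n" by (rule group_twin_group)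
  have "tw_cls n [(i, b)] = tw_gen n i"
  proof (cases b)
    case False
    have "tw_gen n i \<otimes>\<^bsub>twin_group n\<^esub> tw_cls n [(i, b)] = \<one>\<^bsub>twin_group n\<^esub>"
      using tw_cls_eqI[OF pres_cong.cancel[of i "{1..n - 1}" True]] assms(1) False
      by (simp add: tw_cls_mult tw_cls_Nil)
    then show ?thesis
      using tw_gen_square[OF assms(1)] tw_cls_carrier[of "[(i, b)]" n] tw_gen_carrier[OF assms(1)] assms(1)
      by (metis (no_types, lifting) words_Cons words_Nil fst_conv Units_eq Units_l_cancel)
  qed simp
  then show ?thesis using assms tw_cls_mult[of "[(i, b)]" n w] by simp
qed

lemma twin_group_induct [consumes 1, case_names one gen]:
  assumes "x \<in> carrier (twin_group n)" "P \<one>\<^bsub>twin_group n\<^esub>"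
    and "\<And>i x. i \<in> {1..n - 1} \<Longrightarrow> x \<in> carrier (twin_group n) \<Longrightarrow> P x
      \<Longrightarrow> P (tw_gen n i \<otimes>\<^bsub>twin_group n\<^esub> x)"
  shows "P x"
proof -
  have "P (tw_cls n w)" if "w \<in> words {1..n - 1}" for w
    using that
  proof (induction w)
    case Nil
    then show ?case using assms(2) by (simp add: tw_cls_Nil)
  next
    case (Cons p w)
    obtain i b where p: "p = (i, b)" by (cases p)
    then have "i \<in> {1..n - 1}" "w \<in> words {1..n - 1}" using Cons.prems by simp_all
    then show ?case
      using assms(3)[OF _ tw_cls_carrier Cons.IH] tw_cls_Cons[of i n w b] by (simp only: p)
  qed
  then show ?thesis using assms(1) by (auto simp: twin_group_carrier)
qed

definition to_twin :: "nat word set \<Rightarrow> twin" where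
  "to_twin x = abs_twin (map fst (SOME w. w \<in> x))"

lemma pres_cong_abs_twin:
  "(u, v) \<in> pres_cong {1..n - 1} (twin_relations n) \<Longrightarrow> abs_twin (map fst u) = abs_twin (map fst v)"
proof (induction rule: pres_cong.induct)
  case (relation u v)
  have "\<not> dep i j" if "\<bar>int i - int j\<bar> \<ge> 2" for i j using that by (auto simp: dep_def)
  then show ?case using relation(1)
    by (auto simp: twin_relations_def abs_twin_simps tgen_commute)
qed (auto simp: abs_twin_simps)

lemma to_twin_cls:
  assumes "w \<in> words {1..n - 1}"
  shows "to_twin (tw_cls n w) = abs_twin (map fst w)"
proof -
  have "w \<in> tw_cls n w" using assms by (simp add: tw_cls_def pres_cong.refl)
  then have "(SOME v. v \<in> tw_cls n w) \<in> tw_cls n w" by (rule someI)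
  then show ?thesis using pres_cong_abs_twin by (simp add: tw_cls_def to_twin_def)
qed

lemma to_twin_gen: "i \<in> {1..n - 1} \<Longrightarrow> to_twin (tw_gen n i) = tgen i"
  by (simp add: to_twin_cls abs_twin_simps)

lemma to_twin_one: "to_twin \<one>\<^bsub>twin_group n\<^esub> = 0"
  using to_twin_cls[of "[]" n] by (simp add: tw_cls_Nil abs_twin_simps)

lemma to_twin_mult:
  "x \<in> carrier (twin_group n) \<Longrightarrow> y \<in> carrier (twin_group n) \<Longrightarrow>
    to_twin (x \<otimes>\<^bsub>twin_group n\<^esub> y) = to_twin x + to_twin y"
  by (auto simp: twin_group_carrier tw_cls_mult to_twin_cls abs_twin_simps)

lemma to_twin_inv:
  assumes "x \<in> carrier (twin_group n)"
  shows "to_twin (inv\<^bsub>twin_group n\<^esub> x) = - to_twin x"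
proof -
  interpret group "twin_group n" by (rule group_twin_group)
  have "to_twin x + to_twin (inv\<^bsub>twin_group n\<^esub> x) = 0"
    using assms to_twin_mult[of x n "inv\<^bsub>twin_group n\<^esub> x"] by (simp add: to_twin_one)
  then show ?thesis by (simp add: minus_unique)
qed

lemma to_twin_image: "to_twin ` carrier (twin_group n) = {x. supp x \<subseteq> {1..n - 1}}"
proof (intro equalityI subsetI)
  fix x assume "x \<in> to_twin ` carrier (twin_group n)"
  then obtain w where w: "w \<in> words {1..n - 1}" "x = abs_twin (map fst w)"
    by (auto simp: twin_group_carrier to_twin_cls)
  have "set (map fst w) \<subseteq> {1..n - 1}" using w(1) by (induction w) auto
  then show "x \<in> {x. supp x \<subseteq> {1..n - 1}}" using w(2) supp_abs_twin_subset by blast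
next
  fix x assume "x \<in> {x. supp x \<subseteq> {1..n - 1}}"
  then obtain w where w: "x = abs_twin w" "set w \<subseteq> {1..n - 1}"
    by (metis mem_Collect_eq red_repE supp_abs_twin)
  have "map gen w \<in> words {1..n - 1}" using w(2) by (induction w) auto
  moreover have "x = abs_twin (map fst (map gen w))" using w(1) by (simp add: comp_def)
  ultimately show "x \<in> to_twin ` carrier (twin_group n)"
    unfolding twin_group_carrier by (metis imageI to_twin_cls)
qed

text \<open>Generators act on the presented group by left multiplication, and letters out of range
  act trivially. Words with equivalent normal forms send the identity to the same element, which is
  the class of the word.\<close>

lemma to_twin_inj: "inj_on to_twin (carrier (twin_group n))"
proof -
  let ?G = "twin_group n" and ?I = "{1..n - 1}"
  interpret group ?G by (rule group_twin_group)
  define F where "F = (\<lambda>s x. if s \<in> ?I then tw_gen n s \<otimes>\<^bsub>?G\<^esub> x else x)"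
  have F_closed: "F s x \<in> carrier ?G" if "x \<in> carrier ?G" for s x
    unfolding F_def using that tw_gen_carrier by simp
  interpret twin_action "\<lambda>x y. x = y \<and> x \<in> carrier ?G" F
  proof
    fix s t x
    show "F s (F s x) = x \<and> F s (F s x) \<in> carrier ?G" if "x = x \<and> x \<in> carrier ?G"
      using that tw_gen_square[of s n] tw_gen_carrier[of s n]
      by (auto simp: F_def simp flip: m_assoc)
    show "F s (F t x) = F t (F s x) \<and> F s (F t x) \<in> carrier ?G"
      if "x = x \<and> x \<in> carrier ?G" "\<not> dep s t"
      using that tw_gen_commute[of s n t] tw_gen_carrier[of _ n]
      by (auto simp: F_def simp flip: m_assoc)
  qed (auto intro: F_closed)
  have foldr: "foldr F (map fst w) \<one>\<^bsub>?G\<^esub> = tw_cls n w" if "w \<in> words ?I" for w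
    using that
  proof (induction w)
    case (Cons p w)
    obtain i b where p: "p = (i, b)" by (cases p)
    then have "i \<in> ?I" "w \<in> words ?I" using Cons.prems by simp_all
    then show ?case using tw_cls_Cons[of i n w b] Cons.IH by (simp add: F_def p)
  qed (simp add: tw_cls_Nil)
  have inj: "tw_cls n u = tw_cls n v"
    if "u \<in> words ?I" "v \<in> words ?I" "abs_twin (map fst u) = abs_twin (map fst v)" for u v
  proof -
    have "tw_eq (map fst u) (map fst v)" using that(3) by (simp add: twin.abs_eq_iff)
    then show ?thesis
      using foldr_tw_eq[of "\<one>\<^bsub>?G\<^esub>" "map fst u" "map fst v"] foldr[OF that(1)] foldr[OF that(2)]
      by simp
  qed
  show ?thesis
  proof (rule inj_onI)
    fix x y assume "x \<in> carrier ?G" "y \<in> carrier ?G" and eq: "to_twin x = to_twin y"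
    then obtain u v where uv: "u \<in> words ?I" "x = tw_cls n u" "v \<in> words ?I" "y = tw_cls n v"
      unfolding twin_group_carrier by blast
    then show "x = y" using inj[OF uv(1,3)] eq to_twin_cls by simp
  qed
qed

section \<open>Normal automorphisms\<close>

lemma par_kernel_normal: "{x \<in> carrier (twin_group n). \<not> par s (to_twin x)} \<lhd> twin_group n"
proof -
  interpret group "twin_group n" by (rule group_twin_group)
  show ?thesis
    unfolding normal_inv_iff
    by (auto intro!: subgroupI simp: to_twin_mult to_twin_inv)
       (use to_twin_one one_closed par_simps(1) in metis)
qed

text \<open>The automorphism maps the kernel of \<open>par s\<close> onto itself and, being
  injective, sends no other element into it.\<close>

lemma normal_automorphism_par:
  assumes "normal_automorphism (twin_group n) \<phi>" "x \<in> carrier (twin_group n)"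
  shows "par s (to_twin (\<phi> x)) \<longleftrightarrow> par s (to_twin x)"
proof -
  let ?K = "{x \<in> carrier (twin_group n). \<not> par s (to_twin x)}"
  have iso: "\<phi> \<in> iso (twin_group n) (twin_group n)" and "\<phi> ` ?K = ?K"
    using assms(1) par_kernel_normal[of n s] by (auto simp: normal_automorphism_def)
  moreover have "inj_on \<phi> (carrier (twin_group n))" "\<phi> x \<in> carrier (twin_group n)"
    using iso assms(2) by (auto simp: iso_def bij_betw_def)
  ultimately have "\<phi> x \<in> ?K \<longleftrightarrow> x \<in> ?K"
    using inj_on_image_mem_iff[of \<phi> "carrier (twin_group n)" x ?K] assms(2) by auto
  then show ?thesis using assms(2) \<open>\<phi> x \<in> carrier (twin_group n)\<close> by simp
qed

theorem proposition6p14: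
  fixes n :: nat and \<phi> :: "nat word set \<Rightarrow> nat word set"
  assumes "n \<ge> 3"
    and "normal_automorphism (twin_group n) \<phi>"
  shows "inner_automorphism (twin_group n) \<phi>"
proof -
  let ?G = "twin_group n"
  interpret group ?G by (rule group_twin_group)
  have iso: "\<phi> \<in> iso ?G ?G" using assms(2) by (simp add: normal_automorphism_def)
  then have hom: "\<phi> \<in> hom ?G ?G" and surj: "\<phi> ` carrier ?G = carrier ?G"
    by (auto simp: iso_def bij_betw_def)
  have closed: "\<phi> x \<in> carrier ?G" if "x \<in> carrier ?G" for x
    using hom that by (auto simp: hom_def)
  have one: "\<phi> \<one>\<^bsub>?G\<^esub> = \<one>\<^bsub>?G\<^esub>" using hom_one[OF hom is_group is_group] .
  define \<psi> where "\<psi> = to_twin \<circ> \<phi>"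
  have \<psi>_mult: "\<psi> (x \<otimes>\<^bsub>?G\<^esub> y) = \<psi> x + \<psi> y" if "x \<in> carrier ?G" "y \<in> carrier ?G" for x y
    using that closed by (simp add: \<psi>_def hom_mult[OF hom] to_twin_mult)
  have \<psi>_one: "\<psi> \<one>\<^bsub>?G\<^esub> = 0" by (simp add: \<psi>_def one to_twin_one)
  define I where "I = {1..<1 + (n - 1)}"
  have I: "I = {1..n - 1}" by (auto simp: I_def)
  define R where "R = (\<lambda>i. \<psi> (tw_gen n i))"
  have "\<exists>h. supp h \<subseteq> I \<and> (\<forall>i\<in>I. R i = h + tgen i - h)"
    unfolding I_def
  proof (rule simultaneous_conjugation; fold I_def)
    fix i assume i: "i \<in> I"
    have "R i + R i = 0"
      using i \<psi>_mult[of "tw_gen n i" "tw_gen n i"]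
      by (simp add: R_def I tw_gen_carrier tw_gen_square \<psi>_one)
    moreover have "\<forall>s. par s (R i) \<longleftrightarrow> s = i"
      using i normal_automorphism_par[OF assms(2) tw_gen_carrier]
      by (simp add: R_def \<psi>_def I to_twin_gen)
    ultimately show "\<exists>h. R i = h + tgen i - h" by (rule odd_involution)
    show "supp (R i) \<subseteq> I"
      using i closed[OF tw_gen_carrier[of i n]] to_twin_image[of n]
      by (auto simp: R_def \<psi>_def I)
    fix j assume "j \<in> I" "\<not> dep i j"
    then show "R i + R j = R j + R i"
      using i tw_gen_commute[of i n j]
      by (simp add: R_def I tw_gen_carrier flip: \<psi>_mult)
  next
    \<comment> \<open>Surjectivity of \<open>\<phi>\<close> makes \<open>x\<close> a value of
      \<open>\<psi>\<close>, hence a product of elements \<open>R i\<close>.\<close>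
    fix x assume "supp x \<subseteq> I"
    then have "x \<in> \<psi> ` carrier ?G"
      using to_twin_image[of n] surj by (auto simp: \<psi>_def I simp flip: image_image)
    then obtain y where y: "x = \<psi> y" "y \<in> carrier ?G" by blast
    from y(2) have "\<psi> y \<in> cl (R ` I)"
    proof (induction rule: twin_group_induct)
      case (gen i z)
      then show ?case by (auto simp: \<psi>_mult tw_gen_carrier R_def I intro!: cl.step)
    qed (simp add: \<psi>_one cl.zero)
    then show "x \<in> cl (R ` I)" using y by simp
  qed
  then obtain h where "supp h \<subseteq> I" and R: "\<And>i. i \<in> I \<Longrightarrow> R i = h + tgen i - h" by blast
  then have "h \<in> to_twin ` carrier ?G" using to_twin_image[of n] by (simp add: I)
  then obtain g where g: "h = to_twin g" "g \<in> carrier ?G" by blast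
  have "\<phi> x = g \<otimes>\<^bsub>?G\<^esub> x \<otimes>\<^bsub>?G\<^esub> inv\<^bsub>?G\<^esub> g" if x: "x \<in> carrier ?G" for x
  proof -
    \<comment> \<open>Both sides are homomorphisms in \<open>x\<close> that agree on the
      generators.\<close>
    from x have "\<psi> x = h + to_twin x - h"
    proof (induction rule: twin_group_induct)
      case (gen i z)
      then have "\<psi> (tw_gen n i \<otimes>\<^bsub>?G\<^esub> z) = (h + tgen i - h) + (h + to_twin z - h)"
        using R[of i] by (simp add: \<psi>_mult tw_gen_carrier R_def I)
      also have "\<dots> = h + (tgen i + to_twin z) - h"
        by (rule conj_add)
      finally show ?case using gen by (simp add: to_twin_mult tw_gen_carrier to_twin_gen)
    qed (simp add: \<psi>_one to_twin_one)
    then have "to_twin (\<phi> x) = to_twin (g \<otimes>\<^bsub>?G\<^esub> x \<otimes>\<^bsub>?G\<^esub> inv\<^bsub>?G\<^esub> g)"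
      using x g by (simp add: \<psi>_def to_twin_mult to_twin_inv)
    then show ?thesis using closed x g(2) by (intro inj_onD[OF to_twin_inj]) auto
  qed
  then show ?thesis using g(2) unfolding inner_automorphism_def by blast
qed

end
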